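(* For every composition $F$ of $I$, $\mathcal D(\hat{\mathtt{M}}_F)=\check{\mathtt{M}}_F$; that is, under the polyhedral duality $\mathcal D$, the characteristic function of the relatively open face $\hat{\mathtt{M}}_F$ of the braid arrangement is sent to $(-1)^{l(F)-1}$ times the characteristic functional of the relative interior of the permutohedral tangent cone $\sigma^\vee_{\bar F}$.
   Context: Let $\mathbb{k}$ be a field of characteristic zero and $I$ a finite set. Braid side: $\mathrm{T}^I=\mathbb{R}^I/\mathbb{R}\lambda_I$, coroots $h_{i_1i_2}$ with $\langle h_{i_1i_2},\lambda\rangle=\lambda(i_1)-\lambda(i_2)$, halfspaces $\hat{\mathtt{C}}_{i_1i_2}$ (indicator of $\langle h_{i_1i_2},\lambda\rangle\ge0$). For a preposet $p$ (identified with its set of pairs $(i_1,i_2)$, $i_1\ne i_2$, $i_1\ge_p i_2$) the braid cone is $\hat{\mathtt{C}}_p=\prod_{(i_1,i_2)\in p}\hat{\mathtt{C}}_{i_1i_2}$; it is the characteristic function of the cone $\sigma_p$ generated by the fundamental weights $\lambda_{ST}$ (image of the indicator of $S$) with $S$ upward and $T$ downward closed in $p$. Compositions $F$ are identified with total preposets ($i_1\ge i_2$ iff the lump of $i_1$ is weakly left of that of $i_2$); $l(F)$ is the number of lumps and $\bar F$ the composition with lumps in reverse order. The face $\hat{\mathtt{M}}_F:\mathrm{T}^I\to\mathbb{k}$ is the indicator of the set of $\lambda$ whose induced total preorder on $I$ (via $\lambda(i_1)\ge\lambda(i_2)$) equals $F$. $\hat{\mathbf{\Sigma}}^*[I]$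 is the algebra of functions on $\mathrm{T}^I$ generated by the halfspaces. Adjoint side: $\mathrm{T}^\vee_I=\{h\in\mathbb{R}I:\sum_ih_i=0\}$; for each two-lump composition $(S,T)$ the halfspace $\check{\mathtt{Y}}_{ST}$ is the indicator of $\langle h,\lambda_{ST}\rangle\ge0$. The adjoint faces $\check{\mathtt{H}}_{\mathcal S}$ are the indicators of the relatively open faces of the arrangement of special hyperplanes $\langle h,\lambda_{ST}\rangle=0$; the span $\check{\mathbf{\Sigma}}^\vee[I]$ of the algebra generated by the $\check{\mathtt{Y}}_{ST}$ is given the inner product making the adjoint faces orthonormal, and the characteristic functional of a region is the Riesz representative of its characteristic function. $\sigma^\vee_p=\{h:\langle h,\lambda\rangle\ge0\ \forall\lambda\in\sigma_p\}$ is the cone generated by the coroots $h_{i_1i_2}$, $(i_1,i_2)\in p$ (a generalized permutohedral tangent cone; for compositions, a permutohedral tangent cone). $\check{\mathtt{C}}_p$ is the characteristic functional of $\sigma^\vee_p$, $\check{\mathbf{\Sigma}}^*[I]$ is the span of the $\check{\mathtt{C}}_p$, and $\mathcal D:\hat{\mathbf{\Sigma}}^*\to\check{\mathbf{\Sigma}}^*$, $\hat{\mathtt{C}}_p\mapsto\check{\mathtt{C}}_p$, is the linear isomorphism given by duality of polyhedral algebras; it sends pointwise products to convolution $\check{\mathtt{C}}_p\star\check{\mathtt{C}}_q=\check{\mathtt{C}}_{p\cup q}$ ($p\cup q$ the transitive closure of the union). Finally $\check{\mathtt{M}}_F$ denotes $(-1)^{l(F)-1}$ times the characteristic functional of the relative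 interior of $\sigma^\vee_{\bar F}$. *)

theory Defs
  imports "HOL-Analysis.Analysis" "HOL-Library.Function_Algebras"
begin

section \<open>Function spaces over a field\<close>

text \<open>
  Functions carry the pointwise ring structure of \<^theory>\<open>HOL-Library.Function_Algebras\<close>.
\<close>

definition fscale :: "'k::times \<Rightarrow> ('x \<Rightarrow> 'k) \<Rightarrow> 'x \<Rightarrow> 'k" where
  "fscale c f = (\<lambda>x. c * f x)"

global_interpretation fun_space: vector_space "fscale :: 'k::field \<Rightarrow> ('x \<Rightarrow> 'k) \<Rightarrow> 'x \<Rightarrow> 'k"
  by unfold_locales (auto simp: fscale_def fun_eq_iff algebra_simps)

inductive_set generated_algebra :: "('x \<Rightarrow> 'k::field) set \<Rightarrow> ('x \<Rightarrow> 'k) set"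
  for G :: "('x \<Rightarrow> 'k) set" where
  one: "1 \<in> generated_algebra G"
| gen: "g \<in> G \<Longrightarrow> g \<in> generated_algebra G"
| add: "f \<in> generated_algebra G \<Longrightarrow> g \<in> generated_algebra G \<Longrightarrow> f + g \<in> generated_algebra G"
| scale: "f \<in> generated_algebra G \<Longrightarrow> fscale c f \<in> generated_algebra G"
| mult: "f \<in> generated_algebra G \<Longrightarrow> g \<in> generated_algebra G \<Longrightarrow> f * g \<in> generated_algebra G"


section \<open>Compositions and preposets\<close>

text \<open>
  The finite set \<open>I\<close> is the universe of a finite type; it is therefore nonempty.
  A pair \<open>(i, j)\<close> in a preposet is read as \<open>i \<ge> j\<close>. Preposets are kept as reflexive
  relations; the set of pairs of distinct elements is \<open>p - Id\<close>.
\<close>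

definition composition :: "'i set list \<Rightarrow> bool" where
  "composition F \<longleftrightarrow> distinct F \<and> partition_on UNIV (set F)"

definition comp_preposet :: "'i set list \<Rightarrow> 'i rel" where
  "comp_preposet F = {(i, j). \<exists>a b. a \<le> b \<and> b < length F \<and> i \<in> F ! a \<and> j \<in> F ! b}"

definition upward_closed :: "'i rel \<Rightarrow> 'i set \<Rightarrow> bool" where
  "upward_closed p S \<longleftrightarrow> (\<forall>(i, j) \<in> p. j \<in> S \<longrightarrow> i \<in> S)"

definition downward_closed :: "'i rel \<Rightarrow> 'i set \<Rightarrow> bool" where
  "downward_closed p T \<longleftrightarrow> (\<forall>(i, j) \<in> p. i \<in> T \<longrightarrow> j \<in> T)"


section \<open>The two ambient spaces\<close>

quotient_type 'i braid_space = "real ^ ('i::finite)" /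
  "\<lambda>x y. \<exists>c. x - y = (\<chi> i. c)"
proof (rule equivpI)
  show "reflp (\<lambda>x y :: real ^ 'i. \<exists>c. x - y = (\<chi> i. c))"
    by (auto simp: reflp_def vec_eq_iff intro!: exI[of _ 0])
  show "symp (\<lambda>x y :: real ^ 'i. \<exists>c. x - y = (\<chi> i. c))"
  proof (rule sympI)
    fix x y :: "real ^ 'i" assume "\<exists>c. x - y = (\<chi> i. c)"
    then obtain c where "x - y = (\<chi> i. c)" ..
    then have "y - x = (\<chi> i. - c)" by (simp add: vec_eq_iff algebra_simps)
    then show "\<exists>c. y - x = (\<chi> i. c)" ..
  qed
  show "transp (\<lambda>x y :: real ^ 'i. \<exists>c. x - y = (\<chi> i. c))"
  proof (rule transpI)
    fix x y z :: "real ^ 'i"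
    assume "\<exists>c. x - y = (\<chi> i. c)" "\<exists>c. y - z = (\<chi> i. c)"
    then obtain c d where "x - y = (\<chi> i. c)" "y - z = (\<chi> i. d)" by blast
    then have "x - z = (\<chi> i. c + d)" by (simp add: vec_eq_iff algebra_simps)
    then show "\<exists>c. x - z = (\<chi> i. c)" by blast
  qed
qed

instantiation braid_space :: (finite) real_vector
begin

lift_definition zero_braid_space :: "'a braid_space" is 0 .

lift_definition plus_braid_space :: "'a braid_space \<Rightarrow> 'a braid_space \<Rightarrow> 'a braid_space" is "(+)"
proof -
  fix x y u v :: "real ^ 'a"
  assume "\<exists>c. x - y = (\<chi> i. c)" "\<exists>c. u - v = (\<chi> i. c)"
  then obtain c d where "x - y = (\<chi> i. c)" "u - v = (\<chi> i. d)" by blast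
  then have "(x + u) - (y + v) = (\<chi> i. c + d)" by (simp add: vec_eq_iff algebra_simps)
  then show "\<exists>c. (x + u) - (y + v) = (\<chi> i. c)" by blast
qed

lift_definition uminus_braid_space :: "'a braid_space \<Rightarrow> 'a braid_space" is uminus
proof -
  fix x y :: "real ^ 'a"
  assume "\<exists>c. x - y = (\<chi> i. c)"
  then obtain c where "x - y = (\<chi> i. c)" by blast
  then have "- x - - y = (\<chi> i. - c)" by (simp add: vec_eq_iff algebra_simps)
  then show "\<exists>c. - x - - y = (\<chi> i. c)" by blast
qed

lift_definition minus_braid_space :: "'a braid_space \<Rightarrow> 'a braid_space \<Rightarrow> 'a braid_space" is "(-)"
proof -
  fix x y u v :: "real ^ 'a"
  assume "\<exists>c. x - y = (\<chi> i. c)" "\<exists>c. u - v = (\<chi> i. c)"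
  then obtain c d where "x - y = (\<chi> i. c)" "u - v = (\<chi> i. d)" by blast
  then have "(x - u) - (y - v) = (\<chi> i. c - d)" by (simp add: vec_eq_iff algebra_simps)
  then show "\<exists>c. (x - u) - (y - v) = (\<chi> i. c)" by blast
qed

lift_definition scaleR_braid_space :: "real \<Rightarrow> 'a braid_space \<Rightarrow> 'a braid_space" is "(*\<^sub>R)"
proof -
  fix r :: real and x y :: "real ^ 'a"
  assume "\<exists>c. x - y = (\<chi> i. c)"
  then obtain c where "x - y = (\<chi> i. c)" by blast
  then have "r *\<^sub>R x - r *\<^sub>R y = (\<chi> i. r * c)"
    by (simp add: vec_eq_iff flip: right_diff_distrib)
  then show "\<exists>c. r *\<^sub>R x - r *\<^sub>R y = (\<chi> i. c)" by blast
qed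

instance
  by standard
    (transfer, rule exI[of _ 0], simp add: vec_eq_iff algebra_simps)+

end

typedef 'i adjoint_space = "{h :: real ^ ('i::finite). (\<Sum>i\<in>UNIV. h $ i) = 0}"
  by (rule exI[of _ 0]) simp

setup_lifting type_definition_adjoint_space

lift_definition pairing :: "'i::finite adjoint_space \<Rightarrow> 'i braid_space \<Rightarrow> real"
  is "\<lambda>h x. \<Sum>i\<in>UNIV. h $ i * x $ i"
proof -
  fix h x y :: "real ^ 'i"
  assume h: "(\<Sum>i\<in>UNIV. h $ i) = 0" and "\<exists>c. x - y = (\<chi> i. c)"
  then obtain c where c: "x $ i = y $ i + c" for i
    by (auto simp: vec_eq_iff algebra_simps)
  have "(\<Sum>i\<in>UNIV. h $ i * x $ i) = (\<Sum>i\<in>UNIV. h $ i * y $ i) + (\<Sum>i\<in>UNIV. h $ i) * c"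
    by (simp add: c distrib_left sum.distrib sum_distrib_right)
  then show "(\<Sum>i\<in>UNIV. h $ i * x $ i) = (\<Sum>i\<in>UNIV. h $ i * y $ i)"
    by (simp add: h)
qed

lift_definition coroot :: "'i::finite \<Rightarrow> 'i \<Rightarrow> 'i adjoint_space"
  is "\<lambda>i j. axis i 1 - axis j 1"
  by (simp add: axis_def sum_subtractf)

text \<open>
  The weight \<open>\<lambda>\<^sub>S\<^sub>T\<close> of a two-lump composition \<open>(S, T)\<close>; it depends only on \<open>S\<close>.
\<close>

lift_definition fund_weight :: "'i::finite set \<Rightarrow> 'i braid_space"
  is "\<lambda>S. \<chi> i. indicator S i" .


section \<open>The braid side\<close>

definition braid_halfspace :: "'i::finite \<Rightarrow> 'i \<Rightarrow> 'i braid_space \<Rightarrow> 'k::field" where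
  "braid_halfspace i j = indicator {x. pairing (coroot i j) x \<ge> 0}"

definition braid_cone :: "'i::finite rel \<Rightarrow> 'i braid_space \<Rightarrow> 'k::field" where
  "braid_cone p = (\<Prod>(i, j)\<in>p - Id. braid_halfspace i j)"

definition braid_face :: "'i::finite set list \<Rightarrow> 'i braid_space \<Rightarrow> 'k::field" where
  "braid_face F = indicator {x. {(i, j). pairing (coroot i j) x \<ge> 0} = comp_preposet F}"

definition braid_algebra :: "('i::finite braid_space \<Rightarrow> 'k::field) set" where
  "braid_algebra = generated_algebra {braid_halfspace i j | i j. i \<noteq> j}"


section \<open>The adjoint side\<close>

definition adjoint_halfspace :: "'i::finite set \<Rightarrow> 'i adjoint_space \<Rightarrow> 'k::field" where
  "adjoint_halfspace S = indicator {h. pairing h (fund_weight S) \<ge> 0}"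

definition adjoint_algebra :: "('i::finite adjoint_space \<Rightarrow> 'k::field) set" where
  "adjoint_algebra = generated_algebra {adjoint_halfspace S | S T. composition [S, T]}"

definition adjoint_face_of :: "'i::finite adjoint_space \<Rightarrow> 'i adjoint_space set" where
  "adjoint_face_of h = {h'. \<forall>S T. composition [S, T] \<longrightarrow>
     sgn (pairing h' (fund_weight S)) = sgn (pairing h (fund_weight S))}"

definition adjoint_faces :: "('i::finite adjoint_space \<Rightarrow> 'k::field) set" where
  "adjoint_faces = {indicator (adjoint_face_of h) | h. True}"

text \<open>
  The symmetric bilinear form on the span of the adjoint faces for which they are orthonormal:
  \<open>fun_space.representation B f b\<close> is the coefficient of \<open>b\<close> in the expansion of \<open>f\<close>
  in the basis \<open>B\<close>.
\<close>

definition adjoint_inner ::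
  "('i::finite adjoint_space \<Rightarrow> 'k::field) \<Rightarrow> ('i adjoint_space \<Rightarrow> 'k) \<Rightarrow> 'k" where
  "adjoint_inner f g = (\<Sum>b\<in>adjoint_faces.
     fun_space.representation adjoint_faces f b * fun_space.representation adjoint_faces g b)"

text \<open>
  Functionals on \<open>adjoint_algebra\<close> are represented as functions on the whole function space
  that vanish outside \<open>adjoint_algebra\<close>.
\<close>

definition char_functional ::
  "'i::finite adjoint_space set \<Rightarrow> ('i adjoint_space \<Rightarrow> 'k::field) \<Rightarrow> 'k" where
  "char_functional R = (\<lambda>g. if g \<in> adjoint_algebra then adjoint_inner (indicator R) g else 0)"

definition weight_cone :: "'i::finite rel \<Rightarrow> 'i braid_space set" where
  "weight_cone p = convex_cone hull
     {fund_weight S | S T. composition [S, T] \<and> upward_closed p S \<and> downward_closed p T}"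

definition dual_cone :: "'i::finite rel \<Rightarrow> 'i adjoint_space set" where
  "dual_cone p = {h. \<forall>x\<in>weight_cone p. pairing h x \<ge> 0}"

text \<open>The relative interior is taken inside the Euclidean space \<open>\<real>\<^sup>I\<close>.\<close>

definition adjoint_rel_interior :: "'i::finite adjoint_space set \<Rightarrow> 'i adjoint_space set" where
  "adjoint_rel_interior R =
     {h. Rep_adjoint_space h \<in> rel_interior (Rep_adjoint_space ` R)}"

definition adjoint_cone ::
  "'i::finite rel \<Rightarrow> ('i adjoint_space \<Rightarrow> 'k::field) \<Rightarrow> 'k" where
  "adjoint_cone p = char_functional (dual_cone p)"

definition adjoint_cone_span :: "(('i::finite adjoint_space \<Rightarrow> 'k::field) \<Rightarrow> 'k) set" where
  "adjoint_cone_span = fun_space.span {adjoint_cone p | p. preorder_on UNIV p}"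

definition signed_open_cone ::
  "'i::finite set list \<Rightarrow> ('i adjoint_space \<Rightarrow> 'k::field) \<Rightarrow> 'k" where
  "signed_open_cone F = fscale ((- 1) ^ (length F - 1))
     (char_functional (adjoint_rel_interior (dual_cone (comp_preposet (rev F)))))"


section \<open>The polyhedral duality\<close>

text \<open>
  The linear map on \<open>braid_algebra\<close> with \<open>braid_cone p \<mapsto> adjoint_cone p\<close>, extended by \<open>0\<close>
  outside \<open>braid_algebra\<close>. It is determined by these values because the braid cones span
  \<open>braid_algebra\<close>.
\<close>

definition is_polyhedral_duality ::
  "(('i::finite braid_space \<Rightarrow> 'k::field) \<Rightarrow> (('i adjoint_space \<Rightarrow> 'k) \<Rightarrow> 'k)) \<Rightarrow> bool" where
  "is_polyhedral_duality D \<longleftrightarrow>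
     D ` braid_algebra \<subseteq> adjoint_cone_span \<and>
     (\<forall>f\<in>braid_algebra. \<forall>g\<in>braid_algebra. D (f + g) = D f + D g) \<and>
     (\<forall>c. \<forall>f\<in>braid_algebra. D (fscale c f) = fscale c (D f)) \<and>
     (\<forall>p. preorder_on UNIV p \<longrightarrow> D (braid_cone p) = adjoint_cone p) \<and>
     (\<forall>f. f \<notin> braid_algebra \<longrightarrow> D f = 0)"

definition polyhedral_duality ::
  "('i::finite braid_space \<Rightarrow> 'k::field) \<Rightarrow> ('i adjoint_space \<Rightarrow> 'k) \<Rightarrow> 'k" where
  "polyhedral_duality = (THE D. is_polyhedral_duality D)"

end

(*
  A face of the braid arrangement corresponds to a chain of nonempty proper subsets of I, its
  upper level sets. The face lies in the cone of a preposet p iff all members of its chain are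
  upward closed in p. Send the face with chain C to (-1)^|C| times the indicator of
  {h. h(S) < 0 for all S in C}, where h(S) is the sum of the h_i with i in S. The image of the cone
  of p then takes at h the value of the alternating sum over all chains in the poset P of upward
  closed S with h(S) < 0. This is 1 if P is empty, that is, if h lies in the dual cone. Otherwise
  choose M in P with h(M) minimal: modularity of h gives h(S Un M) <= h(S), so S |-> S Un M is a
  closure operator on P which makes the order complex a contractible set, and the sum is 0.
  Hence this map is the duality, and its values on faces are the claimed ones.
*)
theory Submission
  imports Defs
begin

section \<open>Chains of sets\<close>

text \<open>Let \<open>K\<close> be the largest member of \<open>C\<close> not containing \<open>M\<close> (empty if there is none). Adding
  or removing \<open>N C = K \<union> M\<close> does not change \<open>K\<close>, so it is a sign-reversing involution on chains.\<close>

lemma alternating_sum_chains_cone: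
  fixes P :: "'a::finite set set"
  assumes M: "M \<in> P" and un: "\<And>S. S \<in> P \<Longrightarrow> S \<union> M \<in> P"
  shows "(\<Sum>C | subset.chain P C. (- 1) ^ card C) = (0 :: 'k::field_char_0)"
proof -
  define N where "N C = \<Union>{S \<in> C. \<not> M \<subseteq> S} \<union> M" for C
  define \<tau> where "\<tau> C = (if N C \<in> C then C - {N C} else insert (N C) C)" for C
  let ?A = "{C. subset.chain P C}"
  have MN: "M \<subseteq> N C" for C by (auto simp: N_def)
  have N\<tau>: "N (\<tau> C) = N C" for C
  proof -
    have "{S \<in> \<tau> C. \<not> M \<subseteq> S} = {S \<in> C. \<not> M \<subseteq> S}"
      using MN[of C] by (auto simp: \<tau>_def)
    then show ?thesis by (simp add: N_def)
  qed
  have \<tau>\<tau>: "\<tau> (\<tau> C) = C" for C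
    using N\<tau>[of C] by (auto simp: \<tau>_def)
  have \<tau>_chain: "\<tau> C \<in> ?A" if "C \<in> ?A" for C
  proof (cases "N C \<in> C")
    case True
    with that show ?thesis by (auto simp: \<tau>_def subset_chain_def)
  next
    case False
    from that have C: "subset.chain P C" by simp
    \<comment> \<open>If every member of \<open>C\<close> contains \<open>M\<close>, then
      \<open>N C\<close> is \<open>M\<close> itself. Otherwise the finite chain attains the union,
      which therefore lies in \<open>P\<close>, and \<open>un\<close> applies.\<close>
    have "N C \<in> P"
    proof (cases "{S \<in> C. \<not> M \<subseteq> S} = {}")
      case True
      then show ?thesis unfolding N_def True using M by simp
    next
      case False
      have "\<Union>{S \<in> C. \<not> M \<subseteq> S} \<in> {S \<in> C. \<not> M \<subseteq> S}"
        using C False by (intro Union_in_chain[where \<A> = P]) (auto simp: subset_chain_def)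
      then show ?thesis unfolding N_def using C by (auto intro!: un simp: subset_chain_def)
    qed
    \<comment> \<open>A member containing \<open>M\<close> also contains every chain member that
      does not, hence all of \<open>N C\<close>; any other member is one of the sets united in
      \<open>N C\<close>.\<close>
    moreover have "X \<subseteq> N C \<or> N C \<subseteq> X" if "X \<in> C" for X
    proof (cases "M \<subseteq> X")
      case True
      have "S \<subseteq> X" if "S \<in> C" "\<not> M \<subseteq> S" for S
        using C \<open>X \<in> C\<close> that True unfolding subset_chain_def by blast
      with True show ?thesis by (auto simp: N_def)
    next
      case False
      with that show ?thesis by (auto simp: N_def)
    qed
    ultimately show ?thesis
      using False C by (simp add: \<tau>_def subset_chain_insert)
  qed
  have sign: "(- 1) ^ card (\<tau> C) = - ((- 1 :: 'k) ^ card C)" for C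
  proof (cases "N C \<in> C")
    case True
    then have "card C = Suc (card (C - {N C}))" by (intro card.remove) simp
    then have "(- 1 :: 'k) ^ card C = - ((- 1) ^ card (C - {N C}))" by simp
    then show ?thesis using True by (simp add: \<tau>_def)
  qed (simp add: \<tau>_def)
  have "(\<Sum>C\<in>?A. (- 1 :: 'k) ^ card C) = (\<Sum>C\<in>?A. - ((- 1) ^ card C))"
    by (rule sum.reindex_bij_witness[where i = \<tau> and j = \<tau>]) (use \<tau>\<tau> \<tau>_chain sign in auto)
  \<comment> \<open>The sum equals its own negative, so it vanishes in characteristic zero.\<close>
  then show ?thesis by (simp add: sum_negf)
qed

section \<open>Chains of proper subsets and their preorders\<close>

text \<open>Indexes the generators of \<open>weight_cone p\<close>: the second lump is the
  complement of the first and is downward closed as soon as the first is upward closed.\<close>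

definition proper_upsets :: "'i rel \<Rightarrow> 'i set set" where
  "proper_upsets p = {S. S \<noteq> {} \<and> S \<noteq> UNIV \<and> upward_closed p S}"

text \<open>For a proper chain, this is the total preorder of the braid face whose upper level sets
  form that chain.\<close>

definition chain_preorder :: "'i set set \<Rightarrow> 'i rel" where
  "chain_preorder C = {(i, j). \<forall>S\<in>C. j \<in> S \<longrightarrow> i \<in> S}"

text \<open>The empty chain is included; it belongs to the face at the origin, that is, to the
  one-lump composition.\<close>

abbreviation proper_chain :: "'i set set \<Rightarrow> bool" where
  "proper_chain C \<equiv> subset.chain (- {{}, UNIV}) C"

text \<open>Each side unfolds to upward closedness in \<open>p\<close> of all members of
  \<open>C\<close>. This translates containment of a face in a braid cone into a condition on its
  chain.\<close>

lemma proper_chain_subset_upsets_iff: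
  assumes "proper_chain C"
  shows "C \<subseteq> proper_upsets p \<longleftrightarrow> p \<subseteq> chain_preorder C"
  using assms by (fastforce simp: subset_chain_def proper_upsets_def chain_preorder_def upward_closed_def)

text \<open>Shows that distinct chains give distinct faces. An upset \<open>S\<close> is the union
  over \<open>i\<close> in \<open>S\<close> of the intersections over \<open>j\<close> outside
  \<open>S\<close> of members of \<open>C\<close> separating \<open>i\<close> from \<open>j\<close>,
  and a finite chain is closed under nonempty unions and intersections.\<close>

lemma proper_upsets_chain_preorder:
  fixes C :: "'i::finite set set"
  assumes C: "proper_chain C"
  shows "proper_upsets (chain_preorder C) = C"
proof
  show "C \<subseteq> proper_upsets (chain_preorder C)"
    using proper_chain_subset_upsets_iff[OF C] by blast
  show "proper_upsets (chain_preorder C) \<subseteq> C"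
  proof
    fix S assume S: "S \<in> proper_upsets (chain_preorder C)"
    then have ne: "S \<noteq> {}" "- S \<noteq> {}" by (auto simp: proper_upsets_def)
    \<comment> \<open>Otherwise \<open>(j, i)\<close> would lie in the preorder, against the upward
      closedness of \<open>S\<close>.\<close>
    have "\<exists>T\<in>C. i \<in> T \<and> j \<notin> T" if "i \<in> S" "j \<notin> S" for i j
      using S that by (auto simp: proper_upsets_def upward_closed_def chain_preorder_def)
    then obtain T where T: "\<And>i j. i \<in> S \<Longrightarrow> j \<notin> S \<Longrightarrow> T i j \<in> C \<and> i \<in> T i j \<and> j \<notin> T i j"
      by metis
    have sub: "subset.chain C B" if "B \<subseteq> C" for B
      using C that unfolding subset_chain_def by blast
    have "(\<Inter>j\<in>- S. T i j) \<in> C" if "i \<in> S" for i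
    proof -
      have "(\<Inter>j\<in>- S. T i j) \<in> (\<lambda>j. T i j) ` (- S)"
        using T that ne by (intro Inter_in_chain[OF _ _ sub]) auto
      then show ?thesis using T that by auto
    qed
    then have *: "(\<lambda>i. \<Inter>j\<in>- S. T i j) ` S \<subseteq> C" by auto
    have "(\<Union>i\<in>S. \<Inter>j\<in>- S. T i j) \<in> (\<lambda>i. \<Inter>j\<in>- S. T i j) ` S"
      using ne by (intro Union_in_chain[OF _ _ sub[OF *]]) auto
    then have "(\<Union>i\<in>S. \<Inter>j\<in>- S. T i j) \<in> C" using * by blast
    moreover have "(\<Union>i\<in>S. \<Inter>j\<in>- S. T i j) = S" using T by auto
    ultimately show "S \<in> C" by simp
  qed
qed


section \<open>The pairing\<close>

lemma pairing_add: "pairing h (x + y) = pairing h x + pairing h y"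
  by transfer (simp add: distrib_left sum.distrib)

lemma pairing_scaleR: "pairing h (c *\<^sub>R x) = c * pairing h x"
  by transfer (simp add: sum_distrib_left algebra_simps)

lemma pairing_zero: "pairing h 0 = 0"
  by transfer simp

lemma pairing_sum: "pairing h (sum f A) = (\<Sum>a\<in>A. pairing h (f a))"
  by (induction A rule: infinite_finite_induct) (simp_all add: pairing_zero pairing_add)

lemma pairing_fund_weight: "pairing h (fund_weight S) = (\<Sum>i\<in>S. Rep_adjoint_space h $ i)"
  by transfer (simp add: indicator_def if_distrib sum.If_cases cong: if_cong)

lemma sum_Rep_adjoint_space: "(\<Sum>i\<in>UNIV. Rep_adjoint_space h $ i) = 0"
  using Rep_adjoint_space[of h] by simp

lemma pairing_coroot_fund_weight:
  "pairing (coroot i j) (fund_weight S) = indicator S i - indicator S j"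
  by transfer (simp add: axis_def left_diff_distrib sum_subtractf if_distrib[of "\<lambda>c. c * _"] cong: if_cong)

lemma pairing_coroot_self: "pairing (coroot i i) x = 0"
  by transfer simp

lemma pairing_fund_weight_Un_Int:
  "pairing h (fund_weight (S \<union> T)) + pairing h (fund_weight (S \<inter> T))
     = pairing h (fund_weight S) + pairing h (fund_weight T)"
  by (simp add: pairing_fund_weight sum.union_inter)

lemma pairing_fund_weight_empty: "pairing h (fund_weight {}) = 0"
  by (simp add: pairing_fund_weight)

lemma pairing_fund_weight_UNIV: "pairing h (fund_weight UNIV) = 0"
  by (simp add: pairing_fund_weight sum_Rep_adjoint_space)

lemma pairing_fund_weight_Compl:
  "pairing h (fund_weight (- S)) = - pairing h (fund_weight S)"
  using pairing_fund_weight_Un_Int[of h S "- S"]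
  by (simp add: pairing_fund_weight_empty pairing_fund_weight_UNIV)

text \<open>The empty and the full set pair to 0 with \<open>h\<close>, so strict negativity
  excludes them, and unions and intersections may be formed among all upsets. The cone point is a
  minimizer of the pairing.\<close>

lemma alternating_sum_negative_upsets:
  fixes p :: "'i::finite rel"
  defines "P h \<equiv> {S. upward_closed p S \<and> pairing h (fund_weight S) < 0}"
  shows "(\<Sum>C | subset.chain (P h) C. (- 1) ^ card C) = (if P h = {} then 1 else 0 :: 'k::field_char_0)"
proof (cases "P h = {}")
  case True
  then have "{C. subset.chain (P h) C} = {{}}" by (auto simp: subset_chain_def)
  then show ?thesis using True by simp
next
  case False
  let ?w = "\<lambda>S. pairing h (fund_weight S)"
  obtain M where M: "M \<in> P h" and min: "\<And>S. S \<in> P h \<Longrightarrow> ?w M \<le> ?w S"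
    using ex_min_if_finite[of "?w ` P h"] False by (fastforce simp: not_less)
  have "S \<union> M \<in> P h" if "S \<in> P h" for S
  proof -
    have up: "upward_closed p (S \<union> M)" "upward_closed p (S \<inter> M)"
      using that M by (fastforce simp: P_def upward_closed_def)+
    \<comment> \<open>If the intersection has negative weight, minimality of \<open>M\<close>
      applies; otherwise its weight is nonnegative while that of \<open>M\<close> is
      negative.\<close>
    have "?w M \<le> ?w (S \<inter> M)"
      using M min[of "S \<inter> M"] up by (force simp: P_def)
    then have "?w (S \<union> M) \<le> ?w S"
      using pairing_fund_weight_Un_Int[of h S M] by simp
    then show ?thesis using that up by (simp add: P_def)
  qed
  then show ?thesis using alternating_sum_chains_cone[OF M] False by simp
qed


section \<open>The braid side\<close>

definition braid_preorder :: "'i::finite braid_space \<Rightarrow> 'i rel" where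
  "braid_preorder x = {(i, j). pairing (coroot i j) x \<ge> 0}"

text \<open>Provides a point in the face of each chain: its coordinate at \<open>i\<close> counts
  the members containing \<open>i\<close>. Along a chain the families of members containing
  \<open>i\<close> and \<open>j\<close> are nested, so the counts compare like the families.\<close>

lemma braid_preorder_sum_fund_weight:
  fixes C :: "'i::finite set set"
  assumes C: "subset.chain A C"
  shows "braid_preorder (\<Sum>S\<in>C. fund_weight S) = chain_preorder C"
proof -
  have eq: "pairing (coroot i j) (\<Sum>S\<in>C. fund_weight S) = (\<Sum>S\<in>C. indicator S i - indicator S j)" for i j
    by (simp add: pairing_sum pairing_coroot_fund_weight)
  have "(\<Sum>S\<in>C. indicator S i - indicator S j) \<ge> (0 :: real) \<longleftrightarrow> (\<forall>S\<in>C. j \<in> S \<longrightarrow> i \<in> S)" for i j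
  proof
    assume "\<forall>S\<in>C. j \<in> S \<longrightarrow> i \<in> S"
    then show "(\<Sum>S\<in>C. indicator S i - indicator S j) \<ge> (0 :: real)"
      by (intro sum_nonneg) (auto simp: indicator_def)
  next
    assume ge: "(\<Sum>S\<in>C. indicator S i - indicator S j) \<ge> (0 :: real)"
    show "\<forall>S\<in>C. j \<in> S \<longrightarrow> i \<in> S"
    proof (rule ccontr)
      assume "\<not> (\<forall>S\<in>C. j \<in> S \<longrightarrow> i \<in> S)"
      then obtain S where S: "S \<in> C" "j \<in> S" "i \<notin> S" by blast
      \<comment> \<open>With \<open>S\<close> containing \<open>j\<close> but not \<open>i\<close>,
        no member contains \<open>i\<close> without \<open>j\<close>; so no summand is positive, and
        the one for \<open>S\<close> is negative.\<close>
      have *: "j \<in> S'" if "S' \<in> C" "i \<in> S'" for S'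
        using C S that unfolding subset_chain_def by blast
      have "(\<Sum>S\<in>C. indicator S i - indicator S j) < (\<Sum>S\<in>C. 0 :: real)"
        by (rule sum_strict_mono_ex1) (use S * in \<open>auto simp: indicator_def\<close>)
      then show False using ge by simp
    qed
  qed
  then show ?thesis by (simp add: braid_preorder_def chain_preorder_def eq)
qed

lemma prod_fun_apply: "(\<Prod>a\<in>A. f a) x = (\<Prod>a\<in>A. f a x :: 'k::comm_monoid_mult)"
  by (induction A rule: infinite_finite_induct) simp_all

lemma prod_indicator:
  assumes "finite A"
  shows "(\<Prod>a\<in>A. indicator (B a) x) = (indicator {x. \<forall>a\<in>A. x \<in> B a} x :: 'k::field)"
  using assms by induction (auto simp: indicator_def)

lemma braid_cone_eq_indicator:
  "(braid_cone p :: 'i::finite braid_space \<Rightarrow> 'k::field) = indicator {x. p \<subseteq> braid_preorder x}"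
proof
  fix x :: "'i braid_space"
  have "(braid_cone p x :: 'k) = (\<Prod>a\<in>p - Id. indicator {x. a \<in> braid_preorder x} x)"
    unfolding braid_cone_def prod_fun_apply
    by (intro prod.cong) (auto simp: braid_halfspace_def braid_preorder_def)
  also have "\<dots> = indicator {x. \<forall>a\<in>p - Id. a \<in> braid_preorder x} x"
    by (subst prod_indicator) auto
  also have "{x. \<forall>a\<in>p - Id. a \<in> braid_preorder x} = {x. p \<subseteq> braid_preorder x}"
    by (force simp: braid_preorder_def pairing_coroot_self)
  finally show "(braid_cone p x :: 'k) = indicator {x. p \<subseteq> braid_preorder x} x" .
qed

lemma preorder_braid_preorder: "preorder_on UNIV (braid_preorder x)"
proof -
  have "pairing (coroot i k) x = pairing (coroot i j) x + pairing (coroot j k) x" for i j k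
    by transfer (simp add: sum.distrib[symmetric] algebra_simps)
  then have "trans (braid_preorder x)"
    unfolding trans_def braid_preorder_def by (metis (lifting) add_nonneg_nonneg case_prodD case_prodI mem_Collect_eq)
  then show ?thesis
    by (simp add: preorder_on_def refl_on_def braid_preorder_def pairing_coroot_self)
qed

section \<open>Braid cones as a spanning set of the braid algebra\<close>

text \<open>Every \<open>braid_preorder x\<close> is itself reflexive and transitive. Hence cones of
  arbitrary relations are already cones of preposets.\<close>

lemma braid_cone_rtrancl: "braid_cone (p\<^sup>*) = (braid_cone p :: 'i::finite braid_space \<Rightarrow> 'k::field)"
proof -
  have "p\<^sup>* \<subseteq> braid_preorder x \<longleftrightarrow> p \<subseteq> braid_preorder x" for x
  proof
    assume "p \<subseteq> braid_preorder x"
    then have "p\<^sup>* \<subseteq> (braid_preorder x)\<^sup>*" by (rule rtrancl_mono)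
    also have "(braid_preorder x)\<^sup>* = braid_preorder x"
      using preorder_braid_preorder[of x]
      by (auto simp: preorder_on_def refl_on_def rtrancl_eq_or_trancl)
    finally show "p\<^sup>* \<subseteq> braid_preorder x" .
  qed blast
  then show ?thesis by (simp add: braid_cone_eq_indicator)
qed

lemma braid_cone_mult:
  "braid_cone p * braid_cone q = (braid_cone (p \<union> q) :: 'i::finite braid_space \<Rightarrow> 'k::field)"
  by (auto simp: braid_cone_eq_indicator fun_eq_iff indicator_def)

abbreviation braid_cones :: "('i::finite braid_space \<Rightarrow> 'k::field) set" where
  "braid_cones \<equiv> {braid_cone p | p. preorder_on UNIV p}"

lemma braid_cone_in_braid_cones: "braid_cone p \<in> braid_cones"
proof -
  have "preorder_on UNIV (p\<^sup>*)" by (simp add: preorder_on_def refl_rtrancl trans_rtrancl)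
  then show ?thesis by (metis (mono_tags, lifting) braid_cone_rtrancl mem_Collect_eq)
qed

lemma span_braid_cones_mult:
  assumes f: "f \<in> fun_space.span braid_cones" and g: "g \<in> fun_space.span braid_cones"
  shows "f * g \<in> fun_space.span (braid_cones :: ('i::finite braid_space \<Rightarrow> 'k::field) set)"
proof -
  have cone: "braid_cone p * g \<in> fun_space.span braid_cones" for p :: "'i rel"
    using g
  proof (induction rule: fun_space.span_induct_alt)
    case base
    have "braid_cone p * 0 = (0 :: 'i braid_space \<Rightarrow> 'k)" by (simp add: fun_eq_iff)
    then show ?case by (simp only: fun_space.span_zero)
  next
    case (step c x y)
    then obtain q where x: "x = braid_cone q" by auto
    have eq: "braid_cone p * (fscale c x + y) = fscale c (braid_cone (p \<union> q)) + braid_cone p * y"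
      by (simp add: x fun_eq_iff fscale_def distrib_left flip: braid_cone_mult)
    show ?case
      unfolding eq
      by (intro fun_space.span_add fun_space.span_scale fun_space.span_base
          braid_cone_in_braid_cones step.IH)
  qed
  show ?thesis
    using f
  proof (induction rule: fun_space.span_induct_alt)
    case base
    have "0 * g = 0" by (simp add: fun_eq_iff)
    then show ?case by (simp only: fun_space.span_zero)
  next
    case (step c x y)
    then obtain p where x: "x = braid_cone p" by auto
    have eq: "(fscale c x + y) * g = fscale c (x * g) + y * g"
      by (simp add: fun_eq_iff fscale_def distrib_right)
    show ?case
      unfolding eq unfolding x
      by (intro fun_space.span_add fun_space.span_scale cone step.IH)
  qed
qed

lemma braid_algebra_subset_span:
  assumes "f \<in> (braid_algebra :: ('i::finite braid_space \<Rightarrow> 'k::field) set)"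
  shows "f \<in> fun_space.span braid_cones"
  using assms unfolding braid_algebra_def
proof induction
  case one
  have eq: "(1 :: 'i braid_space \<Rightarrow> 'k) = braid_cone {}" by (simp add: braid_cone_def)
  show ?case unfolding eq by (rule fun_space.span_base[OF braid_cone_in_braid_cones])
next
  case (gen g)
  then obtain i j where g: "g = braid_halfspace i j" and "i \<noteq> j" by auto
  then have "{(i, j)} - Id = {(i, j)}" by auto
  then have eq: "g = braid_cone {(i, j)}" by (simp add: braid_cone_def g)
  show ?case unfolding eq by (rule fun_space.span_base[OF braid_cone_in_braid_cones])
qed (rule fun_space.span_add fun_space.span_scale span_braid_cones_mult; assumption)+

lemma generated_algebra_prod:
  assumes "\<And>a. a \<in> A \<Longrightarrow> f a \<in> generated_algebra G"
  shows "(\<Prod>a\<in>A. f a) \<in> generated_algebra G"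
  using assms
  by (induction A rule: infinite_finite_induct) (auto intro: generated_algebra.one generated_algebra.mult)

lemma braid_halfspace_in_braid_algebra: "i \<noteq> j \<Longrightarrow> braid_halfspace i j \<in> braid_algebra"
  by (auto simp: braid_algebra_def intro!: generated_algebra.gen)

lemma braid_cone_in_braid_algebra: "braid_cone p \<in> braid_algebra"
  unfolding braid_cone_def
  using braid_halfspace_in_braid_algebra
  by (auto simp: braid_algebra_def intro!: generated_algebra_prod)

text \<open>The indicator is the product of the halfspaces for pairs in \<open>r\<close> and the
  complementary open halfspaces for pairs outside. Reflexivity keeps the latter pairs off the
  diagonal, where generators exist.\<close>

lemma indicator_preorder_eq_in_braid_algebra:
  fixes r :: "'i::finite rel"
  assumes "refl r"
  shows "(indicator {x. braid_preorder x = r} :: 'i braid_space \<Rightarrow> 'k::field) \<in> braid_algebra"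
proof -
  let ?g = "\<lambda>(i, j). 1 + fscale (- 1) (braid_halfspace i j) :: 'i braid_space \<Rightarrow> 'k"
  have "(indicator {x. braid_preorder x = r} :: 'i braid_space \<Rightarrow> 'k) = braid_cone r * (\<Prod>a\<in>- r. ?g a)"
  proof
    fix x :: "'i braid_space"
    have "(\<Prod>a\<in>- r. ?g a) x = (\<Prod>a\<in>- r. indicator {x. a \<notin> braid_preorder x} x)"
      unfolding prod_fun_apply
      by (intro prod.cong)
        (auto simp: braid_halfspace_def fscale_def braid_preorder_def indicator_def)
    also have "\<dots> = indicator {x. \<forall>a\<in>- r. a \<notin> braid_preorder x} x"
      by (subst prod_indicator) auto
    finally show "(indicator {x. braid_preorder x = r} x :: 'k) = (braid_cone r * (\<Prod>a\<in>- r. ?g a)) x"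
      by (auto simp: braid_cone_eq_indicator indicator_def)
  qed
  moreover have "?g a \<in> generated_algebra {braid_halfspace i j | i j. i \<noteq> j}" if "a \<in> - r" for a
  proof -
    obtain i j where a: "a = (i, j)" by force
    then have "i \<noteq> j" using that assms by (auto simp: refl_on_def)
    then show ?thesis
      unfolding a prod.case
      by (intro generated_algebra.add generated_algebra.one generated_algebra.scale
          generated_algebra.gen) blast
  qed
  ultimately show ?thesis
    using braid_cone_in_braid_algebra[of r]
    by (auto simp: braid_algebra_def intro!: generated_algebra.mult generated_algebra_prod)
qed


section \<open>The adjoint side\<close>

lemma composition_pair_iff:
  "composition [S, T] \<longleftrightarrow> T = - S \<and> S \<noteq> {} \<and> S \<noteq> UNIV"
  by (auto simp: composition_def partition_on_def disjoint_def)

text \<open>Testing on generators suffices, since the points pairing nonnegatively with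
  \<open>h\<close> form a convex cone.\<close>

lemma dual_cone_eq:
  "dual_cone p = {h :: 'i::finite adjoint_space. \<forall>S\<in>proper_upsets p. pairing h (fund_weight S) \<ge> 0}"
proof -
  have "(\<exists>T. composition [S, T] \<and> upward_closed p S \<and> downward_closed p T) \<longleftrightarrow> S \<in> proper_upsets p" for S
    by (auto simp: composition_pair_iff proper_upsets_def upward_closed_def downward_closed_def)
  then have "{fund_weight S | S T. composition [S, T] \<and> upward_closed p S \<and> downward_closed p T}
      = fund_weight ` proper_upsets p"
    by blast
  then have cone: "weight_cone p = convex_cone hull (fund_weight ` proper_upsets p)"
    by (simp add: weight_cone_def)
  have conv: "convex_cone {x. pairing h x \<ge> 0}" for h :: "'i adjoint_space"
    by (auto simp: convex_cone_iff pairing_zero pairing_add pairing_scaleR)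
  have "(\<forall>x\<in>weight_cone p. pairing h x \<ge> 0) \<longleftrightarrow> (\<forall>S\<in>proper_upsets p. pairing h (fund_weight S) \<ge> 0)"
    for h :: "'i adjoint_space"
  proof
    assume "\<forall>S\<in>proper_upsets p. pairing h (fund_weight S) \<ge> 0"
    then have "weight_cone p \<subseteq> {x. pairing h x \<ge> 0}"
      unfolding cone by (intro hull_minimal conv) auto
    then show "\<forall>x\<in>weight_cone p. pairing h x \<ge> 0" by blast
  next
    assume "\<forall>x\<in>weight_cone p. pairing h x \<ge> 0"
    then show "\<forall>S\<in>proper_upsets p. pairing h (fund_weight S) \<ge> 0"
      unfolding cone by (auto intro: hull_inc)
  qed
  then show ?thesis by (simp add: dual_cone_def)
qed

text \<open>The condition on a maximum \<open>t\<close> and a minimum \<open>b\<close> of \<open>p\<close> provides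
  a vector, the coroot of \<open>t\<close> and \<open>b\<close>, on which all defining functionals of the cone are positive.\<close>

lemma adjoint_rel_interior_dual_cone:
  fixes p :: "'i::finite rel"
  assumes t: "\<And>i. (t, i) \<in> p" and b: "\<And>i. (i, b) \<in> p"
  shows "adjoint_rel_interior (dual_cone p) = {h. \<forall>S\<in>proper_upsets p. pairing h (fund_weight S) > 0}"
proof -
  let ?w = "\<lambda>S (v :: real ^ 'i). \<Sum>i\<in>S. v $ i"
  define K where "K = {v. ?w UNIV v = 0 \<and> (\<forall>S\<in>proper_upsets p. ?w S v \<ge> 0)}"
  have K: "Rep_adjoint_space ` dual_cone p = K"
  proof
    show "Rep_adjoint_space ` dual_cone p \<subseteq> K"
      by (auto simp: K_def dual_cone_eq pairing_fund_weight sum_Rep_adjoint_space)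
    show "K \<subseteq> Rep_adjoint_space ` dual_cone p"
    proof
      fix v assume v: "v \<in> K"
      then have "Rep_adjoint_space (Abs_adjoint_space v) = v"
        by (intro Abs_adjoint_space_inverse) (simp add: K_def)
      then show "v \<in> Rep_adjoint_space ` dual_cone p"
        using v by (intro image_eqI[where x = "Abs_adjoint_space v"])
          (auto simp: K_def dual_cone_eq pairing_fund_weight)
    qed
  qed
  have lin: "?w S (a *\<^sub>R x + c *\<^sub>R y) = a * ?w S x + c * ?w S y" for S a c x y
    by (simp add: sum.distrib sum_distrib_left)
  have "convex K"
    unfolding convex_def K_def mem_Collect_eq lin by simp
  have "0 \<in> K" by (simp add: K_def)
  have aff: "affine hull K \<subseteq> {v. ?w UNIV v = 0}"
    by (rule hull_minimal) (auto simp: K_def affine_def lin simp del: vector_add_component vector_scaleR_component)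
  define c where "c = Rep_adjoint_space (coroot t b)"
  have c: "?w S c = 1" if "S \<in> proper_upsets p" for S
  proof -
    have up: "i \<in> S" if "(i, j) \<in> p" "j \<in> S" for i j
      using \<open>S \<in> proper_upsets p\<close> that by (auto simp: proper_upsets_def upward_closed_def)
    have "t \<in> S" "b \<notin> S"
      using that up[OF t] up[OF b] by (auto simp: proper_upsets_def)
    then show ?thesis
      using pairing_coroot_fund_weight[of t b S] by (simp add: c_def pairing_fund_weight)
  qed
  have "c \<in> K" using c by (simp add: K_def c_def sum_Rep_adjoint_space)
  have "rel_interior K = {v. ?w UNIV v = 0 \<and> (\<forall>S\<in>proper_upsets p. ?w S v > 0)}"
  proof (intro subset_antisym subsetI)
    fix z assume z: "z \<in> rel_interior K"
    then have zK: "z \<in> K" using rel_interior_subset by blast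
    \<comment> \<open>The segment from \<open>c\<close> to a relative interior point
      \<open>z\<close> extends slightly past \<open>z\<close> within \<open>K\<close>. As every
      defining functional is 1 at \<open>c\<close>, its value at \<open>z\<close> is at least
      \<open>(e - 1) / e\<close>.\<close>
    obtain e where e: "e > 1" "(1 - e) *\<^sub>R c + e *\<^sub>R z \<in> K"
      using z \<open>c \<in> K\<close> convex_rel_interior_iff[OF \<open>convex K\<close>] by blast
    have "?w S z > 0" if "S \<in> proper_upsets p" for S
    proof -
      have "(1 - e) * ?w S c + e * ?w S z \<ge> 0"
        using e(2) that unfolding K_def mem_Collect_eq lin by blast
      then have "e * ?w S z > 0" using c[OF that] e(1) by simp
      then show ?thesis using e(1) by (simp add: zero_less_mult_iff)
    qed
    then show "z \<in> {v. ?w UNIV v = 0 \<and> (\<forall>S\<in>proper_upsets p. ?w S v > 0)}"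
      using zK by (simp add: K_def)
  next
    fix z assume z: "z \<in> {v. ?w UNIV v = 0 \<and> (\<forall>S\<in>proper_upsets p. ?w S v > 0)}"
    \<comment> \<open>Finitely many strict inequalities persist near \<open>z\<close>, and the
      affine hull stays in the sum-zero hyperplane.\<close>
    let ?T = "\<Inter>S\<in>proper_upsets p. {v. ?w S v > 0}"
    have "open ?T"
      by (intro open_INT ballI open_Collect_less continuous_intros) auto
    moreover have "z \<in> ?T \<inter> K" using z by (auto simp: K_def intro: less_imp_le)
    moreover have "?T \<inter> affine hull K \<subseteq> K"
      using aff by (auto simp: K_def intro: less_imp_le)
    ultimately show "z \<in> rel_interior K" unfolding mem_rel_interior by blast
  qed
  then show ?thesis
    by (auto simp: adjoint_rel_interior_def K pairing_fund_weight sum_Rep_adjoint_space)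
qed

section \<open>Functions constant on adjoint faces and their functionals\<close>

text \<open>The sign vectors take finitely many values and their fibres are the adjoint faces, so
  \<open>f\<close> is a finite combination of face indicators, with values read off at chosen
  representatives.\<close>

lemma span_adjoint_facesI:
  fixes f :: "'i::finite adjoint_space \<Rightarrow> 'k::field"
  assumes f: "\<And>h h'. (\<And>S. sgn (pairing h (fund_weight S)) = sgn (pairing h' (fund_weight S))) \<Longrightarrow> f h = f h'"
  shows "f \<in> fun_space.span adjoint_faces"
proof -
  define s where "s h = (\<lambda>S. sgn (pairing h (fund_weight S)))" for h :: "'i adjoint_space"
  have sgn: "sgn x \<in> {-1, 0, 1}" for x :: real
    by (simp add: sgn_if)
  have "finite {v :: 'i set \<Rightarrow> real. \<forall>S. (S \<in> UNIV \<longrightarrow> v S \<in> {-1, 0, 1}) \<and> (S \<notin> UNIV \<longrightarrow> v S = 0)}"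
    by (rule finite_set_of_finite_funs) auto
  then have fin: "finite (range s)"
    by (rule finite_subset[rotated]) (use sgn in \<open>auto simp: s_def\<close>)
  have face: "indicator {h'. s h' = s h} \<in> (adjoint_faces :: ('i adjoint_space \<Rightarrow> 'k) set)" for h
  proof -
    have "s h' = s h \<longleftrightarrow> h' \<in> adjoint_face_of h" for h'
    proof
      assume h': "h' \<in> adjoint_face_of h"
      have "s h' S = s h S" for S
      proof (cases "S = {} \<or> S = UNIV")
        case True
        then show ?thesis
          by (auto simp: s_def pairing_fund_weight_empty pairing_fund_weight_UNIV)
      next
        case False
        then have "composition [S, - S]" by (simp add: composition_pair_iff)
        then show ?thesis using h' unfolding s_def adjoint_face_of_def by blast
      qed
      then show "s h' = s h" ..
    next
      assume "s h' = s h"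
      then show "h' \<in> adjoint_face_of h"
        unfolding s_def adjoint_face_of_def fun_eq_iff by blast
    qed
    then have "{h'. s h' = s h} = adjoint_face_of h" by blast
    then show ?thesis by (auto simp: adjoint_faces_def)
  qed
  have inv: "f (inv s (s h)) = f h" for h
  proof (rule f)
    fix S
    have "s (inv s (s h)) = s h" by (rule f_inv_into_f) simp
    then show "sgn (pairing (inv s (s h)) (fund_weight S)) = sgn (pairing h (fund_weight S))"
      by (simp add: s_def fun_eq_iff)
  qed
  have "f = (\<Sum>v\<in>range s. fscale (f (inv s v)) (indicator {h. s h = v}))"
  proof
    fix h
    have "(\<Sum>v\<in>range s. fscale (f (inv s v)) (indicator {h. s h = v})) h
        = (\<Sum>v\<in>range s. fscale (f (inv s v)) (indicator {h. s h = v}) h)"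
      using fin by (induction rule: finite_induct) auto
    also have "\<dots> = (\<Sum>v\<in>range s. if v = s h then f (inv s v) else 0)"
      by (intro sum.cong) (auto simp: fscale_def)
    also have "\<dots> = f h" using fin by (simp add: inv)
    finally show "f h = (\<Sum>v\<in>range s. fscale (f (inv s v)) (indicator {h. s h = v})) h" by simp
  qed
  also have "\<dots> \<in> fun_space.span adjoint_faces"
    using face by (intro fun_space.span_sum fun_space.span_scale fun_space.span_base) auto
  finally show ?thesis .
qed

text \<open>Extends \<open>char_functional\<close> from indicators of regions to all functions, so
  that it can be treated as a linear map.\<close>

definition adjoint_functional ::
  "('i::finite adjoint_space \<Rightarrow> 'k::field) \<Rightarrow> ('i adjoint_space \<Rightarrow> 'k) \<Rightarrow> 'k" where
  "adjoint_functional u = (\<lambda>g. if g \<in> adjoint_algebra then adjoint_inner u g else 0)"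

lemma char_functional_eq: "char_functional R = adjoint_functional (indicator R)"
  by (simp add: char_functional_def adjoint_functional_def)

text \<open>On a dependent family \<open>representation\<close> is \<open>0\<close> by convention, hence additive in that case too.\<close>

lemma adjoint_functional_add:
  assumes "u \<in> fun_space.span adjoint_faces" "v \<in> fun_space.span adjoint_faces"
  shows "adjoint_functional (u + v) = adjoint_functional u + adjoint_functional v"
proof -
  have "fun_space.representation adjoint_faces (u + v) b
      = fun_space.representation adjoint_faces u b + fun_space.representation adjoint_faces v b" for b
    using assms
    by (cases "fun_space.independent (adjoint_faces :: ('a adjoint_space \<Rightarrow> 'b) set)")
      (simp add: fun_space.representation_add, simp add: fun_space.representation_def)
  then show ?thesis
    by (auto simp: adjoint_functional_def adjoint_inner_def fun_eq_iff distrib_right sum.distrib)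
qed

lemma adjoint_functional_scale:
  assumes "u \<in> fun_space.span adjoint_faces"
  shows "adjoint_functional (fscale c u) = fscale c (adjoint_functional u)"
proof -
  have "fun_space.representation adjoint_faces (fscale c u) b
      = c * fun_space.representation adjoint_faces u b" for b
    using assms
    by (cases "fun_space.independent (adjoint_faces :: ('a adjoint_space \<Rightarrow> 'b) set)")
      (simp add: fun_space.representation_scale, simp add: fun_space.representation_def)
  then show ?thesis
    by (auto simp: adjoint_functional_def adjoint_inner_def fun_eq_iff fscale_def
        sum_distrib_left mult.assoc)
qed


section \<open>Constructing the duality\<close>

text \<open>For the chain of a composition \<open>F\<close> this is the relative interior of the
  dual cone of the reversed composition, because complementing a set negates its pairing.\<close>

definition negative_on :: "'i::finite set set \<Rightarrow> 'i adjoint_space set" where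
  "negative_on C = {h. \<forall>S\<in>C. pairing h (fund_weight S) < 0}"

text \<open>For a proper chain \<open>C\<close>, the sum of the weights of its members lies in the face of the
  braid arrangement belonging to \<open>C\<close>, and each face belongs to exactly one \<open>C\<close>. So \<open>polar f\<close>
  replaces every face in the expansion of \<open>f\<close> by its signed open dual cone.\<close>

definition polar :: "('i::finite braid_space \<Rightarrow> 'k::field) \<Rightarrow> 'i adjoint_space \<Rightarrow> 'k" where
  "polar f h = (\<Sum>C | proper_chain C.
     (- 1) ^ card C * f (\<Sum>S\<in>C. fund_weight S) * indicator (negative_on C) h)"

lemma polar_add: "polar (f + g) = polar f + polar g"
  by (simp add: polar_def fun_eq_iff algebra_simps sum.distrib)

lemma polar_scale: "polar (fscale c f) = fscale c (polar f)"
  unfolding polar_def fun_eq_iff fscale_def sum_distrib_left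
  by (intro allI sum.cong refl) (simp only: mult_ac)

lemma polar_in_span: "polar f \<in> fun_space.span adjoint_faces"
proof (rule span_adjoint_facesI)
  fix h h' :: "'a adjoint_space"
  assume *: "\<And>S. sgn (pairing h (fund_weight S)) = sgn (pairing h' (fund_weight S))"
  have "pairing h (fund_weight S) < 0 \<longleftrightarrow> pairing h' (fund_weight S) < 0" for S
    using *[of S] by (metis sgn_less)
  then have "h \<in> negative_on C \<longleftrightarrow> h' \<in> negative_on C" for C
    by (simp add: negative_on_def)
  then show "polar f h = polar f h'" by (simp add: polar_def indicator_def)
qed

lemma polar_braid_cone:
  "polar (braid_cone p) = (indicator (dual_cone p) :: 'i::finite adjoint_space \<Rightarrow> 'k::field_char_0)"
proof
  fix h :: "'i adjoint_space"
  let ?P = "{S. upward_closed p S \<and> pairing h (fund_weight S) < 0}"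
  have P: "?P = {S \<in> proper_upsets p. pairing h (fund_weight S) < 0}"
    by (auto simp: proper_upsets_def pairing_fund_weight_empty pairing_fund_weight_UNIV)
  have val: "(braid_cone p (\<Sum>S\<in>C. fund_weight S) :: 'k) = (if C \<subseteq> proper_upsets p then 1 else 0)"
    if "proper_chain C" for C
    using that braid_preorder_sum_fund_weight[OF that] proper_chain_subset_upsets_iff[OF that]
    by (simp add: braid_cone_eq_indicator)
  have "polar (braid_cone p) h
      = (\<Sum>C | proper_chain C. if subset.chain ?P C then (- 1 :: 'k) ^ card C else 0)"
    unfolding polar_def P
    \<comment> \<open>The face of \<open>C\<close> lies in the braid cone iff \<open>C\<close>
      consists of upsets of \<open>p\<close>, and \<open>h\<close> lies in
      \<open>negative_on C\<close> iff all its members pair negatively; only chains in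
      \<open>?P\<close> survive.\<close>
    by (intro sum.cong refl) (auto simp: val negative_on_def indicator_def subset_chain_def)
  also have "\<dots> = (\<Sum>C | subset.chain ?P C. (- 1) ^ card C)"
    unfolding P by (intro sum.mono_neutral_cong_right) (auto simp: subset_chain_def proper_upsets_def)
  also have "\<dots> = (if ?P = {} then 1 else 0)"
    by (rule alternating_sum_negative_upsets)
  also have "\<dots> = indicator (dual_cone p) h"
    unfolding P by (auto simp: dual_cone_eq indicator_def not_less)
  finally show "polar (braid_cone p) h = (indicator (dual_cone p) h :: 'k)" .
qed

lemma polar_indicator_preorder:
  fixes C :: "'i::finite set set"
  assumes C: "proper_chain C"
  shows "polar (indicator {x. braid_preorder x = chain_preorder C})
       = fscale ((- 1) ^ card C) (indicator (negative_on C) :: 'i adjoint_space \<Rightarrow> 'k::field_char_0)"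
proof
  fix h :: "'i adjoint_space"
  have iff: "braid_preorder (\<Sum>S\<in>C'. fund_weight S) = chain_preorder C \<longleftrightarrow> C' = C"
    if "proper_chain C'" for C'
    unfolding braid_preorder_sum_fund_weight[OF that]
    using arg_cong[where f = proper_upsets, of "chain_preorder C'" "chain_preorder C"]
    unfolding proper_upsets_chain_preorder[OF that] proper_upsets_chain_preorder[OF C] by blast
  have "polar (indicator {x. braid_preorder x = chain_preorder C}) h
      = (\<Sum>C' | proper_chain C'. if C' = C then (- 1 :: 'k) ^ card C * indicator (negative_on C) h else 0)"
    unfolding polar_def
    by (intro sum.cong refl) (simp add: iff indicator_def[of "{x. braid_preorder x = chain_preorder C}"])
  also have "\<dots> = fscale ((- 1) ^ card C) (indicator (negative_on C)) h"
    using C by (simp add: fscale_def)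
  finally show "polar (indicator {x. braid_preorder x = chain_preorder C}) h
      = (fscale ((- 1) ^ card C) (indicator (negative_on C)) h :: 'k)" .
qed

section \<open>Uniqueness and identification of the duality\<close>

lemma is_polyhedral_duality_unique:
  fixes D D' :: "('i::finite braid_space \<Rightarrow> 'k::field) \<Rightarrow> ('i adjoint_space \<Rightarrow> 'k) \<Rightarrow> 'k"
  assumes D: "is_polyhedral_duality D" and D': "is_polyhedral_duality D'"
  shows "D = D'"
proof
  fix f :: "'i braid_space \<Rightarrow> 'k"
  \<comment> \<open>Membership is carried through the induction because linearity of
    \<open>D\<close> and \<open>D'\<close> is only given on the algebra.\<close>
  have "f \<in> braid_algebra \<and> D f = D' f" if "f \<in> fun_space.span braid_cones"
    using that
  proof (induction rule: fun_space.span_induct_alt)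
    case base
    have 1: "(1 :: 'i braid_space \<Rightarrow> 'k) \<in> braid_algebra"
      by (simp add: braid_algebra_def generated_algebra.one)
    \<comment> \<open>Writing zero as a multiple of the unit lets the scaling law determine both
      values there.\<close>
    have 0: "(0 :: 'i braid_space \<Rightarrow> 'k) = fscale 0 1" by (simp add: fscale_def fun_eq_iff)
    have "(0 :: 'i braid_space \<Rightarrow> 'k) \<in> braid_algebra"
      using 1 unfolding 0 braid_algebra_def by (rule generated_algebra.scale)
    moreover have "D 0 = fscale 0 (D 1)" "D' 0 = fscale 0 (D' 1)"
      using D D' 1 unfolding 0 is_polyhedral_duality_def by blast+
    ultimately show ?case by (simp only: fun_space.scale_zero_left simp_thms)
  next
    case (step c x y)
    then obtain p where p: "x = braid_cone p" "preorder_on UNIV p" by auto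
    have x: "x \<in> braid_algebra" by (simp add: p braid_cone_in_braid_algebra)
    then have cx: "fscale c x \<in> braid_algebra"
      by (simp add: braid_algebra_def generated_algebra.scale)
    have E: "E (fscale c x + y) = fscale c (adjoint_cone p) + E y" if E: "is_polyhedral_duality E" for E
    proof -
      have "E (fscale c x + y) = E (fscale c x) + E y" "E (fscale c x) = fscale c (E x)"
        "E x = adjoint_cone p"
        using E x cx step.IH p unfolding is_polyhedral_duality_def by blast+
      then show ?thesis by (simp only:)
    qed
    have "fscale c x + y \<in> braid_algebra"
      using cx step.IH unfolding braid_algebra_def by (intro generated_algebra.add) blast+
    moreover have "D (fscale c x + y) = D' (fscale c x + y)"
      unfolding E[OF D] E[OF D'] using step.IH by (simp only:)
    ultimately show ?case ..
  qed
  then have "D f = D' f" if "f \<in> braid_algebra"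
    using braid_algebra_subset_span[OF that] by blast
  moreover have "D f = 0" "D' f = 0" if "f \<notin> braid_algebra"
    using D D' that unfolding is_polyhedral_duality_def by blast+
  ultimately show "D f = D' f" by (cases "f \<in> braid_algebra") (simp_all only: not_False_eq_True)
qed

text \<open>The explicit map satisfies all the conditions, and uniqueness identifies it with the
  definite description. Its values lie in the required span because braid cones span the
  algebra.\<close>

lemma polyhedral_duality_eq:
  "(polyhedral_duality :: ('i::finite braid_space \<Rightarrow> 'k::field_char_0) \<Rightarrow> _)
     = (\<lambda>f. if f \<in> braid_algebra then adjoint_functional (polar f) else 0)" (is "_ = ?D")
proof -
  have alg: "f + g \<in> braid_algebra" "fscale c f \<in> braid_algebra"
    if "f \<in> braid_algebra" "g \<in> braid_algebra" for c and f g :: "'i braid_space \<Rightarrow> 'k"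
    using that unfolding braid_algebra_def by (blast intro: generated_algebra.add generated_algebra.scale)+
  have cone: "adjoint_functional (polar (braid_cone p)) = (adjoint_cone p :: _ \<Rightarrow> 'k)" for p :: "'i rel"
    by (simp add: polar_braid_cone adjoint_cone_def char_functional_eq)
  have add: "adjoint_functional (polar (f + g)) = adjoint_functional (polar f) + adjoint_functional (polar g)"
    for f g :: "'i braid_space \<Rightarrow> 'k"
    unfolding polar_add by (rule adjoint_functional_add[OF polar_in_span polar_in_span])
  have scale: "adjoint_functional (polar (fscale c f)) = fscale c (adjoint_functional (polar f))"
    for c and f :: "'i braid_space \<Rightarrow> 'k"
    unfolding polar_scale by (rule adjoint_functional_scale[OF polar_in_span])
  have span: "adjoint_functional (polar f) \<in> adjoint_cone_span"
    if "f \<in> fun_space.span braid_cones" for f :: "'i braid_space \<Rightarrow> 'k"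
    using that
  proof (induction rule: fun_space.span_induct_alt)
    case base
    have "adjoint_functional (polar (0 :: 'i braid_space \<Rightarrow> 'k)) = 0"
      using scale[of 0 0] by (simp only: fun_space.scale_zero_left)
    then show ?case by (simp only: adjoint_cone_span_def fun_space.span_zero)
  next
    case (step c x y)
    then obtain p where p: "x = braid_cone p" "preorder_on UNIV p" by auto
    have "adjoint_functional (polar x) \<in> {adjoint_cone p | p. preorder_on UNIV p}"
      using p cone by blast
    then show ?case
      using step.IH unfolding add scale adjoint_cone_span_def
      by (blast intro: fun_space.span_add fun_space.span_scale fun_space.span_base)
  qed
  have "is_polyhedral_duality ?D"
    using span[OF braid_algebra_subset_span] alg
    unfolding is_polyhedral_duality_def
    by (auto simp only: if_True if_False cone add scale braid_cone_in_braid_algebra)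
  then show ?thesis
    unfolding polyhedral_duality_def
    by (rule the_equality[where P = is_polyhedral_duality])
      (rule is_polyhedral_duality_unique[OF _ \<open>is_polyhedral_duality ?D\<close>])
qed


section \<open>Compositions\<close>

lemma comp_preposet_eqI:
  assumes "\<And>i. s i < length G" "\<And>a i. a < length G \<Longrightarrow> i \<in> G ! a \<longleftrightarrow> a = s i"
  shows "comp_preposet G = {(i, j). s i \<le> s j}"
proof -
  have "(i, j) \<in> comp_preposet G \<longleftrightarrow> s i \<le> s j" for i j
  proof
    assume "(i, j) \<in> comp_preposet G"
    then obtain a b where "a \<le> b" "b < length G" "i \<in> G ! a" "j \<in> G ! b"
      unfolding comp_preposet_def by blast
    then show "s i \<le> s j" using assms(2) by (metis le_less_trans)
  next
    assume "s i \<le> s j"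
    then show "(i, j) \<in> comp_preposet G"
      using assms unfolding comp_preposet_def by blast
  qed
  then show ?thesis by auto
qed

text \<open>\<open>r\<close> is the index of the lump of an element, so greater elements have
  smaller rank; nonempty lumps make every index occur.\<close>

lemma composition_rank:
  assumes F: "composition F"
  obtains r :: "'i \<Rightarrow> nat" where "range r = {..<length F}"
    "comp_preposet F = {(i, j). r i \<le> r j}" "comp_preposet (rev F) = {(i, j). r j \<le> r i}"
proof -
  let ?n = "length F"
  have ex: "\<exists>a<?n. i \<in> F ! a" for i
    using F by (auto simp: composition_def partition_on_def in_set_conv_nth) (metis UNIV_I UnionE in_set_conv_nth)
  then obtain r where r: "\<And>i. r i < ?n" "\<And>i. i \<in> F ! r i" by metis
  have uniq: "a = r i" if "a < ?n" "i \<in> F ! a" for a i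
  proof (rule ccontr)
    assume "a \<noteq> r i"
    then have "F ! a \<noteq> F ! r i"
      using F that r(1) by (simp add: composition_def nth_eq_iff_index_eq)
    then have "F ! a \<inter> F ! r i = {}"
      using F that r(1)[of i] by (auto simp: composition_def partition_on_def disjoint_def)
    then show False using that r(2)[of i] by auto
  qed
  have lump: "i \<in> F ! a \<longleftrightarrow> a = r i" if "a < ?n" for a i
    using uniq[OF that] r(2) by auto
  have "a \<in> range r" if "a < ?n" for a
  proof -
    have "F ! a \<noteq> {}" using F that by (metis composition_def partition_on_def nth_mem)
    then show ?thesis using lump[OF that] by blast
  qed
  then have "range r = {..<?n}" using r(1) by auto
  moreover have "comp_preposet F = {(i, j). r i \<le> r j}"
    using r(1) lump by (rule comp_preposet_eqI)
  moreover have "comp_preposet (rev F) = {(i, j). r j \<le> r i}"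
  proof -
    have rev: "i \<in> rev F ! a \<longleftrightarrow> a = ?n - Suc (r i)" if "a < ?n" for a i
    proof -
      have "?n - Suc a = r i \<longleftrightarrow> a = ?n - Suc (r i)" using that r(1)[of i] by auto
      then show ?thesis using that by (simp add: rev_nth lump)
    qed
    have "comp_preposet (rev F) = {(i, j). ?n - Suc (r i) \<le> ?n - Suc (r j)}"
      using r(1) rev by (intro comp_preposet_eqI) (auto intro: diff_Suc_less le_less_trans)
    moreover have "?n - Suc (r i) \<le> ?n - Suc (r j) \<longleftrightarrow> r j \<le> r i" for i j
      using r(1)[of i] r(1)[of j] by auto
    ultimately show ?thesis by auto
  qed
  ultimately show ?thesis by (rule that)
qed

text \<open>An upset is the initial segment up to its largest rank. Cutoffs run from 1 to
  \<open>n - 1\<close>, since 0 gives the empty set and \<open>n\<close> everything.\<close>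

lemma proper_upsets_rank:
  fixes r :: "'i::finite \<Rightarrow> nat"
  assumes "range r = {..<n}"
  shows "proper_upsets {(i, j). r i \<le> r j} = (\<lambda>a. {i. r i < a}) ` {1..<n}"
proof (intro subset_antisym subsetI)
  fix S assume S: "S \<in> proper_upsets {(i, j). r i \<le> r j}"
  let ?m = "Max (r ` S)"
  have "?m \<in> r ` S" using S by (intro Max_in) (auto simp: proper_upsets_def)
  then obtain j where j: "j \<in> S" "?m = r j" by auto
  have "r i \<le> ?m" if "i \<in> S" for i using that by (intro Max_ge) auto
  moreover have "i \<in> S" if "r i \<le> ?m" for i
    using S j that by (auto simp: proper_upsets_def upward_closed_def)
  ultimately have eq: "S = {i. r i < Suc ?m}" unfolding less_Suc_eq_le by blast
  have "Suc ?m < n"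
  proof (rule ccontr)
    assume "\<not> Suc ?m < n"
    moreover have "r i < n" for i using assms by auto
    ultimately have "r i < Suc ?m" for i by (meson leI less_le_trans)
    then have "{i. r i < Suc ?m} = UNIV" by blast
    with eq have "S = UNIV" by (rule trans)
    then show False using S by (simp add: proper_upsets_def)
  qed
  then show "S \<in> (\<lambda>a. {i. r i < a}) ` {1..<n}" using eq by (intro image_eqI[where x = "Suc ?m"]) simp_all
next
  fix S assume "S \<in> (\<lambda>a. {i. r i < a}) ` {1..<n}"
  then obtain a where "a \<in> {1..<n}" and S: "S = {i. r i < a}" by blast
  then have a: "0 < a" "a < n" by simp_all
  then have "0 \<in> range r" "a \<in> range r" by (simp_all add: assms)
  then obtain i j where "0 = r i" "a = r j" by blast
  then have "i \<in> S" "j \<notin> S" using a by (simp_all add: S)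
  moreover have "upward_closed {(i, j). r i \<le> r j} S" by (auto simp: S upward_closed_def)
  ultimately show "S \<in> proper_upsets {(i, j). r i \<le> r j}"
    unfolding proper_upsets_def by blast
qed

lemma card_proper_upsets_rank:
  fixes r :: "'i::finite \<Rightarrow> nat"
  assumes "range r = {..<n}"
  shows "card (proper_upsets {(i, j). r i \<le> r j}) = n - 1"
proof -
  have "inj_on (\<lambda>a. {i. r i < a}) {1..<n}"
  proof (rule linorder_inj_onI')
    fix a b assume "a \<in> {1..<n}" "b \<in> {1..<n}" "a < b"
    then obtain i where "r i = a" using assms by (metis atLeastLessThan_iff imageE lessThan_iff)
    then show "{i. r i < a} \<noteq> {i. r i < b}" using \<open>a < b\<close> by blast
  qed
  then show ?thesis by (simp add: proper_upsets_rank[OF assms] card_image)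
qed

lemma subset_chain_preorder_proper_upsets: "p \<subseteq> chain_preorder (proper_upsets p)"
  by (auto simp: chain_preorder_def proper_upsets_def upward_closed_def)

lemma chain_preorder_proper_upsets_rank:
  fixes r :: "'i::finite \<Rightarrow> nat"
  shows "chain_preorder (proper_upsets {(i, j). r i \<le> r j}) = {(i, j). r i \<le> r j}" (is "?L = ?p")
proof (rule subset_antisym[OF subrelI subset_chain_preorder_proper_upsets])
  fix i j assume ij: "(i, j) \<in> ?L"
  have "r i \<le> r j"
  proof (rule ccontr)
    assume "\<not> r i \<le> r j"
    \<comment> \<open>This segment contains \<open>j\<close> but not \<open>i\<close>, so it is a
      proper upset violating the assumed pair.\<close>
    then have "{k. r k \<le> r j} \<in> proper_upsets ?p"
      by (auto simp: proper_upsets_def upward_closed_def)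
    then show False using ij \<open>\<not> r i \<le> r j\<close> by (auto simp: chain_preorder_def)
  qed
  then show "(i, j) \<in> ?p" by simp
qed

lemma proper_upsets_converse: "proper_upsets (p\<inverse>) = uminus ` proper_upsets p"
proof -
  have *: "- S \<in> proper_upsets (q\<inverse>)" if "S \<in> proper_upsets q" for S and q :: "'a rel"
    using that by (auto simp: proper_upsets_def upward_closed_def)
  show ?thesis
  proof
    show "proper_upsets (p\<inverse>) \<subseteq> uminus ` proper_upsets p"
    proof
      fix S assume "S \<in> proper_upsets (p\<inverse>)"
      then have "- S \<in> proper_upsets p" using *[of S "p\<inverse>"] by simp
      then show "S \<in> uminus ` proper_upsets p"
        by (intro image_eqI[where x = "- S"]) simp_all
    qed
    show "uminus ` proper_upsets p \<subseteq> proper_upsets (p\<inverse>)"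
      using * by blast
  qed
qed

theorem mainTheorem8:
  fixes F :: "'i::finite set list"
  assumes "composition F"
  shows "polyhedral_duality (braid_face F :: 'i braid_space \<Rightarrow> 'k::field_char_0)
       = signed_open_cone F"
proof -
  obtain r :: "'i \<Rightarrow> nat" where r: "range r = {..<length F}"
    and p: "comp_preposet F = {(i, j). r i \<le> r j}"
    and q: "comp_preposet (rev F) = {(i, j). r j \<le> r i}"
    using assms by (rule composition_rank)
  define C where "C = proper_upsets {(i, j). r i \<le> r j}"
  have nested: "{i. r i < a} \<subseteq> {i. r i < b} \<or> {i. r i < b} \<subseteq> {i. r i < a}" for a b
    by (cases "a \<le> b") auto
  have "C \<subseteq> - {{}, UNIV}" by (auto simp: C_def proper_upsets_def)
  then have C: "proper_chain C"
    using nested unfolding C_def proper_upsets_rank[OF r] subset_chain_def by blast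
  have face: "(braid_face F :: 'i braid_space \<Rightarrow> 'k) = indicator {x. braid_preorder x = chain_preorder C}"
    by (simp add: C_def chain_preorder_proper_upsets_rank braid_face_def braid_preorder_def p)
  have mem: "(braid_face F :: 'i braid_space \<Rightarrow> 'k) \<in> braid_algebra"
    unfolding face by (rule indicator_preorder_eq_in_braid_algebra) (auto simp: refl_on_def chain_preorder_def)
  have "0 < length F" using r by (metis UNIV_not_empty image_is_empty lessThan_empty_iff neq0_conv)
  \<comment> \<open>Elements of the first and last lump: in the reversed composition
    \<open>t\<close> is a maximum and \<open>b\<close> a minimum, as the relative interior lemma
    requires.\<close>
  then obtain b t where b: "r b = 0" and t: "r t = length F - 1"
    using r by (metis diff_less imageE lessThan_iff zero_less_one)
  have le: "r i \<le> r t" for i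
  proof -
    have "r i \<in> {..<length F}" unfolding r[symmetric] by simp
    then show ?thesis using t by simp
  qed
  have "adjoint_rel_interior (dual_cone (comp_preposet (rev F)))
      = {h. \<forall>S\<in>proper_upsets (comp_preposet (rev F)). pairing h (fund_weight S) > 0}"
    by (rule adjoint_rel_interior_dual_cone[where t = t and b = b]) (auto simp: q b le)
  also have "comp_preposet (rev F) = {(i, j). r i \<le> r j}\<inverse>" by (auto simp: q)
  also have "{h. \<forall>S\<in>proper_upsets ({(i, j). r i \<le> r j}\<inverse>). pairing h (fund_weight S) > 0} = negative_on C"
    \<comment> \<open>Reversal replaces upsets by their complements, which turns positive pairings
      into negative ones.\<close>
    by (simp only: proper_upsets_converse) (auto simp: C_def negative_on_def pairing_fund_weight_Compl)
  finally have open_cone: "adjoint_rel_interior (dual_cone (comp_preposet (rev F))) = negative_on C"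
    by (simp add: q converse_unfold)
  have "(indicator (negative_on C) :: 'i adjoint_space \<Rightarrow> 'k) \<in> fun_space.span adjoint_faces"
    by (rule span_adjoint_facesI) (auto simp: negative_on_def indicator_def, (metis sgn_less)+)
  then have "adjoint_functional (polar (braid_face F :: 'i braid_space \<Rightarrow> 'k)) =
      fscale ((- 1) ^ card C) (char_functional (negative_on C))"
    unfolding face polar_indicator_preorder[OF C]
    by (simp add: adjoint_functional_scale char_functional_eq)
  \<comment> \<open>A composition has one proper upset per gap between consecutive lumps, which
    gives the sign exponent.\<close>
  moreover have "card C = length F - 1"
    unfolding C_def by (rule card_proper_upsets_rank[OF r])
  ultimately show ?thesis
    by (simp add: polyhedral_duality_eq mem signed_open_cone_def open_cone)
qed

end
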